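(* For nonzero parameters $a,b,c\in\mathbb C$, the map $$T_{a,b,c}:(x_1,x_2,y_1,y_2,z_1,z_2)\mapsto\left(y_1,\ \frac{ax_1x_2y_2}{ay_2z_1+bx_1x_2z_2},\ x_1,\ \frac{bx_2z_2}{ac},\ \frac{y_1z_1}{x_1},\ \frac{ay_2z_1+bx_1x_2z_2}{ax_1x_2}\right)$$ can be restricted, on a level set of its invariants $I_1=x_1y_1$, $I_2=x_1+y_1$, $I_3=y_1z_1$, to the three-dimensional noninvolutive parametric map $$(x,y,z)\mapsto\left(\frac{axy}{ay+bxz},\ \frac{bxz}{ac},\ \frac{ay+bxz}{ax}\right).$$
   Context: All maps are rational maps. "Can be restricted on a level set of its invariants" means: there are constants $k_1,k_2,k_3$ (independent of $a,b,c$) such that $T_{a,b,c}$ maps the common level set $\{I_1=k_1,I_2=k_2,I_3=k_3\}$ to itself and, in suitable coordinates $(x,y,z)$ on this level set (independent of $a,b,c$, here $(x,y,z)=(x_2,y_2,z_2)$), the induced map is the displayed one. Noninvolutive means that the composition of the map with itself is not the identity. *)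

theory Defs
  imports "HOL-Analysis.Analysis" "HOL-Library.Numeral_Type"
begin

inductive polynomial_fun :: "(complex ^ 'n::finite \<Rightarrow> complex) \<Rightarrow> bool" where
  const: "polynomial_fun (\<lambda>v. k)"
| coord: "polynomial_fun (\<lambda>v. v $ i)"
| add: "polynomial_fun p \<Longrightarrow> polynomial_fun q \<Longrightarrow> polynomial_fun (\<lambda>v. p v + q v)"
| mult: "polynomial_fun p \<Longrightarrow> polynomial_fun q \<Longrightarrow> polynomial_fun (\<lambda>v. p v * q v)"

definition polynomial_map :: "(complex ^ 'n::finite \<Rightarrow> complex ^ 'm::finite) \<Rightarrow> bool" where
  "polynomial_map f \<longleftrightarrow> (\<forall>j. polynomial_fun (\<lambda>v. f v $ j))"

text \<open>
  A rational map is a partial map, undefined exactly where one of the denominators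
  of the chosen representing fractions vanishes. As no denominator is the zero polynomial,
  the domain is the complement of a hypersurface, hence nonempty and Zariski dense.
\<close>

definition rational_map :: "(complex ^ 'n::finite \<Rightarrow> (complex ^ 'm::finite) option) \<Rightarrow> bool" where
  "rational_map F \<longleftrightarrow>
    (\<exists>num den.
      (\<forall>j. polynomial_fun (num j) \<and> polynomial_fun (den j) \<and> (\<exists>v. den j v \<noteq> 0)) \<and>
      (\<forall>v. F v = (if \<forall>j. den j v \<noteq> 0 then Some (\<chi> j. num j v / den j v) else None)))"

definition invariant_of ::
    "(complex ^ 'n::finite \<Rightarrow> (complex ^ 'n) option) \<Rightarrow> (complex ^ 'n \<Rightarrow> complex) \<Rightarrow> bool" where
  "invariant_of F I \<longleftrightarrow> (\<forall>v w. F v = Some w \<longrightarrow> I w = I v)"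

text \<open>
  Two rational maps of affine space are equal iff they agree wherever both are defined. So a
  self-composition differs from the identity iff it moves a point of its domain.
\<close>

definition noninvolutive :: "(complex ^ 'n::finite \<Rightarrow> (complex ^ 'n) option) \<Rightarrow> bool" where
  "noninvolutive F \<longleftrightarrow> (\<exists>v \<in> dom (F \<circ>\<^sub>m F). (F \<circ>\<^sub>m F) v \<noteq> Some v)"

definition coordinates_on ::
    "(complex ^ 'n::finite) set \<Rightarrow> (complex ^ 'n \<Rightarrow> complex ^ 'm::finite) \<Rightarrow> bool" where
  "coordinates_on V \<phi> \<longleftrightarrow>
    polynomial_map \<phi> \<and>
    (\<exists>\<psi>. polynomial_map \<psi> \<and> (\<forall>w. \<psi> w \<in> V \<and> \<phi> (\<psi> w) = w) \<and> (\<forall>v\<in>V. \<psi> (\<phi> v) = v))"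

text \<open>
  The second conjunct includes equality of domains: a point of \<open>V\<close> lies in the domain of \<open>F\<close>
  iff its coordinates lie in the domain of \<open>G\<close>. If \<open>\<phi>\<close> are coordinates on \<open>V\<close> and \<open>G\<close> is a
  rational map, it follows that the domain of \<open>F\<close> is dense in \<open>V\<close>.
\<close>

definition restricts_to ::
    "(complex ^ 'n::finite \<Rightarrow> (complex ^ 'n) option) \<Rightarrow> (complex ^ 'n) set \<Rightarrow>
     (complex ^ 'n \<Rightarrow> complex ^ 'm::finite) \<Rightarrow> (complex ^ 'm \<Rightarrow> (complex ^ 'm) option) \<Rightarrow> bool" where
  "restricts_to F V \<phi> G \<longleftrightarrow>
    (\<forall>v\<in>V. \<forall>w. F v = Some w \<longrightarrow> w \<in> V) \<and>
    (\<forall>v\<in>V. map_option \<phi> (F v) = G (\<phi> v))"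

text \<open>
  A vector of \<open>complex ^ 6\<close> lists the variables in the order \<open>x1, x2, y1, y2, z1, z2\<close>.
\<close>

definition T :: "complex \<Rightarrow> complex \<Rightarrow> complex \<Rightarrow> complex ^ 6 \<Rightarrow> (complex ^ 6) option" where
  "T a b c v =
    (let x1 = v $ 1; x2 = v $ 2; y1 = v $ 3; y2 = v $ 4; z1 = v $ 5; z2 = v $ 6 in
     if a * y2 * z1 + b * x1 * x2 * z2 \<noteq> 0 \<and> a * c \<noteq> 0 \<and> x1 \<noteq> 0 \<and> a * x1 * x2 \<noteq> 0
     then Some (vector
       [y1,
        (a * x1 * x2 * y2) / (a * y2 * z1 + b * x1 * x2 * z2),
        x1,
        (b * x2 * z2) / (a * c),
        (y1 * z1) / x1,
        (a * y2 * z1 + b * x1 * x2 * z2) / (a * x1 * x2)])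
     else None)"

definition I1 :: "complex ^ 6 \<Rightarrow> complex" where
  "I1 v = (let x1 = v $ 1; y1 = v $ 3 in x1 * y1)"

definition I2 :: "complex ^ 6 \<Rightarrow> complex" where
  "I2 v = (let x1 = v $ 1; y1 = v $ 3 in x1 + y1)"

definition I3 :: "complex ^ 6 \<Rightarrow> complex" where
  "I3 v = (let y1 = v $ 3; z1 = v $ 5 in y1 * z1)"

definition level_set :: "complex \<Rightarrow> complex \<Rightarrow> complex \<Rightarrow> (complex ^ 6) set" where
  "level_set k1 k2 k3 = {v. I1 v = k1 \<and> I2 v = k2 \<and> I3 v = k3}"

definition coord_xyz :: "complex ^ 6 \<Rightarrow> complex ^ 3" where
  "coord_xyz v = (let x2 = v $ 2; y2 = v $ 4; z2 = v $ 6 in vector [x2, y2, z2])"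

definition S :: "complex \<Rightarrow> complex \<Rightarrow> complex \<Rightarrow> complex ^ 3 \<Rightarrow> (complex ^ 3) option" where
  "S a b c w =
    (let x = w $ 1; y = w $ 2; z = w $ 3 in
     if a * y + b * x * z \<noteq> 0 \<and> a * c \<noteq> 0 \<and> a * x \<noteq> 0
     then Some (vector
       [(a * x * y) / (a * y + b * x * z),
        (b * x * z) / (a * c),
        (a * y + b * x * z) / (a * x)])
     else None)"

end

theory Submission
  imports Defs
begin

text \<open>
  On a level set, \<open>x1\<close> and \<open>y1\<close> are the two roots of \<open>t\<^sup>2 - k2 t + k1\<close>, which \<open>T\<close> interchanges. At
  \<open>(k1, k2) = (1, 2)\<close> both roots are \<open>1\<close>, so the level set with \<open>k3 = 1\<close> is the single affine
  3-space \<open>x1 = y1 = z1 = 1\<close>, and substituting these values into \<open>T\<close> gives \<open>S\<close>. For all nonzero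
  parameters, the square of \<open>S\<close> moves the point \<open>(1, 1, 0)\<close>.
\<close>

lemma exhaust_6: "x = 1 \<or> x = 2 \<or> x = 3 \<or> x = 4 \<or> x = 5 \<or> x = 6"
  for x :: 6
proof (induct x)
  case (of_int z)
  then have "0 \<le> z" and "z < 6"
    by simp_all
  then have "z = 0 \<or> z = 1 \<or> z = 2 \<or> z = 3 \<or> z = 4 \<or> z = 5"
    by arith
  then show ?case
    by auto
qed

lemma forall_6: "(\<forall>i::6. P i) \<longleftrightarrow> P 1 \<and> P 2 \<and> P 3 \<and> P 4 \<and> P 5 \<and> P 6"
  by (metis exhaust_6)

lemma vector_6 [simp]:
  "(vector [x1, x2, x3, x4, x5, x6] :: 'a::zero ^ 6) $ 1 = x1"
  "(vector [x1, x2, x3, x4, x5, x6] :: 'a::zero ^ 6) $ 2 = x2"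
  "(vector [x1, x2, x3, x4, x5, x6] :: 'a::zero ^ 6) $ 3 = x3"
  "(vector [x1, x2, x3, x4, x5, x6] :: 'a::zero ^ 6) $ 4 = x4"
  "(vector [x1, x2, x3, x4, x5, x6] :: 'a::zero ^ 6) $ 5 = x5"
  "(vector [x1, x2, x3, x4, x5, x6] :: 'a::zero ^ 6) $ 6 = x6"
  unfolding vector_def by simp_all

lemma rational_map_T:
  assumes "a \<noteq> 0" "c \<noteq> 0"
  shows "rational_map (T a b c)"
proof -
  define D where "D v = a * v $ 4 * v $ 5 + b * v $ 1 * v $ 2 * v $ 6" for v :: "complex ^ 6"
  \<comment> \<open>The two components of \<open>T\<close> that only swap coordinates are polynomial
    and get the denominator 1. The remaining denominators are the four tested in
    \<open>T\<close>.\<close>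
  define num where "num j v = (vector [v $ 3, a * v $ 1 * v $ 2 * v $ 4, v $ 1, b * v $ 2 * v $ 6,
      v $ 3 * v $ 5, D v] :: complex ^ 6) $ j" for j and v :: "complex ^ 6"
  define den where "den j v = (vector [1, D v, 1, a * c, v $ 1, a * v $ 1 * v $ 2] :: complex ^ 6) $ j"
    for j and v :: "complex ^ 6"
  have "\<forall>j. polynomial_fun (num j) \<and> polynomial_fun (den j)"
    unfolding forall_6 num_def den_def vector_6 D_def by (intro conjI polynomial_fun.intros)
  \<comment> \<open>One point serves all six denominators: \<open>z2 = 0\<close> removes the term
    with \<open>b\<close>, so \<open>D\<close> takes the value \<open>a\<close> there.\<close>
  moreover have "den j (vector [1, 1, 1, 1, 1, 0]) \<noteq> 0" for j
    using assms exhaust_6[of j] by (auto simp: den_def D_def)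
  moreover have "T a b c v = (if \<forall>j. den j v \<noteq> 0 then Some (\<chi> j. num j v / den j v) else None)" for v
    by (auto simp: T_def Let_def forall_6 num_def den_def D_def vec_eq_iff)
  ultimately show ?thesis
    unfolding rational_map_def by blast
qed

lemma rational_map_S:
  assumes "a \<noteq> 0" "c \<noteq> 0"
  shows "rational_map (S a b c)"
proof -
  define D where "D v = a * v $ 2 + b * v $ 1 * v $ 3" for v :: "complex ^ 3"
  define num where "num j v = (vector [a * v $ 1 * v $ 2, b * v $ 1 * v $ 3, D v] :: complex ^ 3) $ j"
    for j and v :: "complex ^ 3"
  define den where "den j v = (vector [D v, a * c, a * v $ 1] :: complex ^ 3) $ j"
    for j and v :: "complex ^ 3"
  have "\<forall>j. polynomial_fun (num j) \<and> polynomial_fun (den j)"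
    unfolding forall_3 num_def den_def vector_3 D_def by (intro conjI polynomial_fun.intros)
  moreover have "den j (vector [1, 1, 0]) \<noteq> 0" for j
    using assms exhaust_3[of j] by (auto simp: den_def D_def)
  moreover have "S a b c v = (if \<forall>j. den j v \<noteq> 0 then Some (\<chi> j. num j v / den j v) else None)" for v
    by (auto simp: S_def Let_def forall_3 num_def den_def D_def vec_eq_iff)
  ultimately show ?thesis
    unfolding rational_map_def by blast
qed

text \<open>\<open>I1\<close> and \<open>I2\<close> are symmetric in \<open>x1\<close> and
  \<open>y1\<close>, which \<open>T\<close> swaps. For \<open>I3\<close>, the new \<open>y1\<close>
  is \<open>x1\<close>, which cancels the denominator of the new \<open>z1\<close>.\<close>

lemma invariants_T:
  "invariant_of (T a b c) I1" "invariant_of (T a b c) I2" "invariant_of (T a b c) I3"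
  by (auto simp: invariant_of_def T_def I1_def I2_def I3_def Let_def split: if_splits)

lemma noninvolutive_S:
  assumes "a \<noteq> 0" "b \<noteq> 0" "c \<noteq> 0"
  shows "noninvolutive (S a b c)"
proof -
  \<comment> \<open>The orbit is (1, 1, 0), (1, 0, 1), (0, b/(ac), b/a). The denominator
    \<open>a * y + b * x * z\<close> equals \<open>a\<close> at the first point and \<open>b\<close>
    at the second, so both steps are defined.\<close>
  have "(S a b c \<circ>\<^sub>m S a b c) (vector [1, 1, 0]) = Some (vector [0, b / (a * c), b / a])"
    using assms by (simp add: map_comp_def S_def Let_def)
  moreover have "(vector [0, b / (a * c), b / a] :: complex ^ 3) \<noteq> vector [1, 1, 0]"
    by (simp add: vec_eq_iff forall_3)
  ultimately show ?thesis
    unfolding noninvolutive_def by (intro bexI[of _ "vector [1, 1, 0]"]) auto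
qed

lemma level_set_1_2_1: "level_set 1 2 1 = {v. v $ 1 = 1 \<and> v $ 3 = 1 \<and> v $ 5 = 1}"
proof -
  have "x = 1" if "x * y = 1" "x + y = 2" for x y :: complex
  proof -
    \<comment> \<open>Substituting \<open>y = 2 - x\<close> into \<open>x * y = 1\<close> gives this
      double root.\<close>
    have "(x - 1)\<^sup>2 = 0"
      using that by algebra
    then show ?thesis
      by simp
  qed
  then have "x * y = 1 \<and> x + y = 2 \<and> y * z = 1 \<longleftrightarrow> x = 1 \<and> y = 1 \<and> z = 1"
    for x y z :: complex
    by force
  then show ?thesis
    by (simp add: level_set_def I1_def I2_def I3_def Let_def)
qed

lemma coordinates_on_level_set: "coordinates_on (level_set 1 2 1) coord_xyz"
proof -
  \<comment> \<open>The inverse of the projection puts the constant 1 in the slots of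
    \<open>x1\<close>, \<open>y1\<close> and \<open>z1\<close>.\<close>
  define \<psi> where "\<psi> w = (vector [1, w $ 1, 1, w $ 2, 1, w $ 3] :: complex ^ 6)" for w :: "complex ^ 3"
  have "polynomial_map coord_xyz"
    unfolding polynomial_map_def coord_xyz_def Let_def forall_3 vector_3
    by (intro conjI polynomial_fun.intros)
  moreover have "polynomial_map \<psi>"
    unfolding polynomial_map_def \<psi>_def forall_6 vector_6 by (intro conjI polynomial_fun.intros)
  moreover have "\<psi> w \<in> level_set 1 2 1 \<and> coord_xyz (\<psi> w) = w" for w
    by (simp add: level_set_1_2_1 \<psi>_def coord_xyz_def Let_def vec_eq_iff forall_3)
  moreover have "\<psi> (coord_xyz v) = v" if "v \<in> level_set 1 2 1" for v
    using that by (simp add: level_set_1_2_1 \<psi>_def coord_xyz_def Let_def vec_eq_iff forall_6)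
  ultimately show ?thesis
    unfolding coordinates_on_def by blast
qed

text \<open>Preservation of the level set is the invariance of its three equations. With
  \<open>x1 = y1 = z1 = 1\<close> the domain condition of \<open>T\<close> also becomes that of
  \<open>S\<close>, so the maps agree even where they are undefined.\<close>

lemma restricts_to_S: "restricts_to (T a b c) (level_set 1 2 1) coord_xyz (S a b c)"
  unfolding restricts_to_def
proof (intro conjI ballI allI impI)
  fix v w
  assume "v \<in> level_set 1 2 1" "T a b c v = Some w"
  then show "w \<in> level_set 1 2 1"
    using invariants_T[of a b c] by (simp add: level_set_def invariant_of_def)
next
  fix v
  assume "v \<in> level_set 1 2 1"
  then show "map_option coord_xyz (T a b c v) = S a b c (coord_xyz v)"
    by (simp add: level_set_1_2_1 T_def S_def coord_xyz_def Let_def)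
qed

theorem proposition4p7:
  "(\<forall>a b c. a \<noteq> 0 \<and> b \<noteq> 0 \<and> c \<noteq> 0 \<longrightarrow>
      rational_map (T a b c) \<and>
      invariant_of (T a b c) I1 \<and> invariant_of (T a b c) I2 \<and> invariant_of (T a b c) I3 \<and>
      rational_map (S a b c) \<and> noninvolutive (S a b c)) \<and>
   (\<exists>k1 k2 k3. coordinates_on (level_set k1 k2 k3) coord_xyz \<and>
      (\<forall>a b c. a \<noteq> 0 \<and> b \<noteq> 0 \<and> c \<noteq> 0 \<longrightarrow>
        restricts_to (T a b c) (level_set k1 k2 k3) coord_xyz (S a b c)))"
proof (intro conjI)
  show "\<exists>k1 k2 k3. coordinates_on (level_set k1 k2 k3) coord_xyz \<and>
      (\<forall>a b c. a \<noteq> 0 \<and> b \<noteq> 0 \<and> c \<noteq> 0 \<longrightarrow>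
        restricts_to (T a b c) (level_set k1 k2 k3) coord_xyz (S a b c))"
    \<comment> \<open>The instance 1 serves both \<open>k1\<close> and \<open>k3\<close>.\<close>
    by (intro exI[of _ 1] exI[of _ 2] conjI coordinates_on_level_set allI impI restricts_to_S)
qed (simp add: rational_map_T rational_map_S invariants_T noninvolutive_S)

end
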